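(* Let $G$ be a finitely generated group, and let $H\le G$ be a subgroup of finite index $[G:H]<\infty$. Let $d$ be a Banach metric on $G$, and let $d_H$ be the metric on $H$ induced from $d$ by restriction, i.e. $d_H(x,y)=d(x,y)$ for $x,y\in H$. Then $d_H$ is a Banach metric on $H$.
   Context: Cayley metric: for a finite symmetric generating set $S=S^{-1}$ of a group $G$, the Cayley graph has vertex set $G$ and edges $x\sim y\iff x^{-1}y\in S$; $d_S$ is its graph metric (the word metric). Quasi-isometry: metric spaces $(X,d)$, $(Y,\rho)$ are quasi-isometric if there are a map $\varphi:X\to Y$ and $C>0$ such that for every $y\in Y$ there is $x\in X$ with $\rho(\varphi(x),y)\le C$, and $C^{-1}d(x,x')-C\le\rho(\varphi(x),\varphi(x'))\le C\,d(x,x')+C$ for all $x,x'\in X$. Metric-functional boundary: for a metric $d$ on a group $G$ with base point $1$, let $L(G,d)$ be the set of functions $h:G\to\mathbb{R}$ with $h(1)=0$ and $|h(x)-h(y)|\le d(x,y)$ for all $x,y\in G$, with the topology of pointwise convergence. For $x\in G$ let $b_x(y)=d(x,y)-d(x,1)$. Let $\overline{(G,d)}$ be the closure of $\{b_x : x\in G\}$ in $L(G,d)$, and $\partial(G,d)=\overline{(G,d)}\setminus\{b_x : x\in G\}$; its elements are called metric-functionals. Banach metric: let $G$ be a finitely generated infinite group. A metric $d$ on $G$ is a Banach metric if: (1) $d(x,y)$ is a non-negative integer for all $x,y\in G$; (2) $d(zx,zy)=d(x,y)$ for all $x,y,z\in G$; (3) for every $r>0$ the ball $\{x\in G : d(x,1)\le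 r\}$ is finite; (4) $(G,d)$ is quasi-isometric to a Cayley graph of $G$ (i.e. to $(G,d_S)$ for some finite symmetric generating set $S$); (5) every $h\in\partial(G,d)$ is an unbounded function on $G$. *)

theory Defs
  imports "HOL-Analysis.Analysis" "HOL-Algebra.Generated_Groups"
begin

section \<open>Generating sets and Cayley metrics\<close>

definition finitely_generated_group :: "('a, 'b) monoid_scheme \<Rightarrow> bool" where
  "finitely_generated_group G \<longleftrightarrow>
     (\<exists>S. finite S \<and> S \<subseteq> carrier G \<and> generate G S = carrier G)"

definition fin_sym_generating_set :: "('a, 'b) monoid_scheme \<Rightarrow> 'a set \<Rightarrow> bool" where
  "fin_sym_generating_set G S \<longleftrightarrow>
     finite S \<and> S \<subseteq> carrier G \<and> m_inv G ` S = S \<and> generate G S = carrier G"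

definition cayley_edges :: "('a, 'b) monoid_scheme \<Rightarrow> 'a set \<Rightarrow> ('a \<times> 'a) set" where
  "cayley_edges G S =
     {(x, y). x \<in> carrier G \<and> y \<in> carrier G \<and> inv\<^bsub>G\<^esub> x \<otimes>\<^bsub>G\<^esub> y \<in> S}"

text \<open>A pair lies in the \<open>n\<close>-th relational power of the edge relation iff it is joined by a walk
  with \<open>n\<close> edges.\<close>

definition cayley_dist :: "('a, 'b) monoid_scheme \<Rightarrow> 'a set \<Rightarrow> 'a \<Rightarrow> 'a \<Rightarrow> nat" where
  "cayley_dist G S x y = (LEAST n. (x, y) \<in> cayley_edges G S ^^ n)"

text \<open>The constructor \<open>metric\<close> is meaningful only on actual metrics;
  \<open>Metric_space_cayley\<close> below shows that this is the case here.\<close>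

definition cayley_metric :: "('a, 'b) monoid_scheme \<Rightarrow> 'a set \<Rightarrow> 'a metric" where
  "cayley_metric G S = metric (carrier G, \<lambda>x y. real (cayley_dist G S x y))"

lemma cayley_walk_generate:
  assumes "group G" and S: "fin_sym_generating_set G S"
    and "g \<in> generate G S" and "x \<in> carrier G"
  shows "\<exists>n. (x, x \<otimes>\<^bsub>G\<^esub> g) \<in> cayley_edges G S ^^ n"
proof -
  interpret group G by fact
  have SG: "S \<subseteq> carrier G" and Sinv: "m_inv G ` S = S"
    using S by (auto simp: fin_sym_generating_set_def)
  have step: "\<exists>n. (x, x \<otimes>\<^bsub>G\<^esub> s) \<in> cayley_edges G S ^^ n"
    if "s \<in> S" "x \<in> carrier G" for s x
  proof -
    have "s \<in> carrier G" using that SG by blast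
    then have "(x, x \<otimes>\<^bsub>G\<^esub> s) \<in> cayley_edges G S"
      using that by (simp add: cayley_edges_def m_assoc [symmetric])
    then have "(x, x \<otimes>\<^bsub>G\<^esub> s) \<in> cayley_edges G S ^^ 1" by simp
    then show ?thesis by blast
  qed
  from assms(3,4) show ?thesis
  proof (induction arbitrary: x rule: generate.induct)
    case one
    then have "(x, x \<otimes>\<^bsub>G\<^esub> \<one>\<^bsub>G\<^esub>) \<in> cayley_edges G S ^^ 0" by simp
    then show ?case by blast
  next
    case (incl h)
    then show ?case using step by blast
  next
    case (inv h)
    then show ?case using step Sinv by blast
  next
    case (eng h1 h2)
    have h: "h1 \<in> carrier G" "h2 \<in> carrier G"
      using eng.hyps generate_in_carrier [OF SG] by blast+
    obtain m where m: "(x, x \<otimes>\<^bsub>G\<^esub> h1) \<in> cayley_edges G S ^^ m"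
      using eng by blast
    obtain n where n: "(x \<otimes>\<^bsub>G\<^esub> h1, x \<otimes>\<^bsub>G\<^esub> h1 \<otimes>\<^bsub>G\<^esub> h2) \<in> cayley_edges G S ^^ n"
      using eng h by blast
    have "(x, x \<otimes>\<^bsub>G\<^esub> h1 \<otimes>\<^bsub>G\<^esub> h2) \<in> cayley_edges G S ^^ (m + n)"
      using m n by (auto simp: relpow_add)
    then show ?case using h eng.prems by (auto simp: m_assoc)
  qed
qed

lemma cayley_walk_exists:
  assumes "group G" and S: "fin_sym_generating_set G S"
    and xy: "x \<in> carrier G" "y \<in> carrier G"
  shows "(x, y) \<in> cayley_edges G S ^^ cayley_dist G S x y"
proof -
  interpret group G by fact
  have "inv\<^bsub>G\<^esub> x \<otimes>\<^bsub>G\<^esub> y \<in> generate G S"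
    using S xy by (simp add: fin_sym_generating_set_def)
  from cayley_walk_generate [OF assms(1,2) this xy(1)]
  have "\<exists>n. (x, y) \<in> cayley_edges G S ^^ n"
    using xy by (simp add: m_assoc [symmetric])
  then show ?thesis
    unfolding cayley_dist_def by (rule LeastI_ex)
qed

lemma cayley_dist_le:
  "(x, y) \<in> cayley_edges G S ^^ n \<Longrightarrow> cayley_dist G S x y \<le> n"
  unfolding cayley_dist_def by (rule Least_le)

lemma sym_cayley_edges:
  assumes "group G" and S: "fin_sym_generating_set G S"
  shows "sym (cayley_edges G S)"
proof (rule symI)
  interpret group G by fact
  fix x y assume "(x, y) \<in> cayley_edges G S"
  then have xy: "x \<in> carrier G" "y \<in> carrier G" and "inv\<^bsub>G\<^esub> x \<otimes>\<^bsub>G\<^esub> y \<in> S"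
    by (auto simp: cayley_edges_def)
  then have "inv\<^bsub>G\<^esub> (inv\<^bsub>G\<^esub> x \<otimes>\<^bsub>G\<^esub> y) \<in> S"
    using S unfolding fin_sym_generating_set_def by blast
  then show "(y, x) \<in> cayley_edges G S"
    using xy by (simp add: cayley_edges_def inv_mult_group)
qed

lemma Metric_space_cayley:
  assumes "group G" and S: "fin_sym_generating_set G S"
  shows "Metric_space (carrier G) (\<lambda>x y. real (cayley_dist G S x y))"
proof -
  have sym: "(y, x) \<in> cayley_edges G S ^^ n" if "(x, y) \<in> cayley_edges G S ^^ n" for x y n
    using that
  proof (induction n arbitrary: y)
    case (Suc n)
    then obtain z where "(z, x) \<in> cayley_edges G S ^^ n" "(z, y) \<in> cayley_edges G S"
      by auto
    then show ?case
      using sym_cayley_edges [OF assms] by (meson relpow_Suc_I2 symE)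
  qed auto
  have comm: "cayley_dist G S x y = cayley_dist G S y x" for x y
    unfolding cayley_dist_def using sym by metis
  show ?thesis
  proof
    fix x y assume xy: "x \<in> carrier G" "y \<in> carrier G"
    have "cayley_dist G S x y = 0 \<longleftrightarrow> x = y"
    proof
      assume "cayley_dist G S x y = 0"
      then show "x = y" using cayley_walk_exists [OF assms xy] by simp
    next
      assume "x = y"
      then show "cayley_dist G S x y = 0" using cayley_dist_le [of x y 0 G S] by simp
    qed
    then show "real (cayley_dist G S x y) = 0 \<longleftrightarrow> x = y"
      by simp
  next
    fix x y z assume xyz: "x \<in> carrier G" "y \<in> carrier G" "z \<in> carrier G"
    have "(x, z) \<in> cayley_edges G S ^^ (cayley_dist G S x y + cayley_dist G S y z)"
      using cayley_walk_exists [OF assms xyz(1,2)] cayley_walk_exists [OF assms xyz(2,3)]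
      by (auto simp: relpow_add)
    then have "cayley_dist G S x z \<le> cayley_dist G S x y + cayley_dist G S y z"
      by (rule cayley_dist_le)
    then show "real (cayley_dist G S x z)
      \<le> real (cayley_dist G S x y) + real (cayley_dist G S y z)"
      by linarith
  qed (auto simp: comm)
qed

lemma
  assumes "group G" and "fin_sym_generating_set G S"
  shows mspace_cayley_metric: "mspace (cayley_metric G S) = carrier G"
    and mdist_cayley_metric: "mdist (cayley_metric G S) x y = real (cayley_dist G S x y)"
  using Metric_space_cayley [OF assms]
  by (simp_all add: cayley_metric_def Metric_space.mspace_metric Metric_space.mdist_metric)


section \<open>Quasi-isometry\<close>

definition quasi_isometric :: "'a metric \<Rightarrow> 'b metric \<Rightarrow> bool" where
  "quasi_isometric X Y \<longleftrightarrow>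
     (\<exists>\<phi> \<in> mspace X \<rightarrow> mspace Y. \<exists>C::real. C > 0 \<and>
        (\<forall>y \<in> mspace Y. \<exists>x \<in> mspace X. mdist Y (\<phi> x) y \<le> C) \<and>
        (\<forall>x \<in> mspace X. \<forall>x' \<in> mspace X.
           inverse C * mdist X x x' - C \<le> mdist Y (\<phi> x) (\<phi> x') \<and>
           mdist Y (\<phi> x) (\<phi> x') \<le> C * mdist X x x' + C))"


section \<open>Metric-functionals\<close>

text \<open>Functions on the group are represented by extensional functions (equal to \<open>undefined\<close> outside
  the carrier), so that equality of functions on \<open>G\<close> is equality in HOL and the topology of
  pointwise convergence is the product topology \<open>powertop_real (carrier G)\<close>.\<close>

definition lipschitz_functionals :: "('a, 'b) monoid_scheme \<Rightarrow> 'a metric \<Rightarrow> ('a \<Rightarrow> real) set" where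
  "lipschitz_functionals G d =
     {h \<in> extensional (carrier G). h \<one>\<^bsub>G\<^esub> = 0 \<and>
        (\<forall>x \<in> carrier G. \<forall>y \<in> carrier G. \<bar>h x - h y\<bar> \<le> mdist d x y)}"

definition lipschitz_topology ::
    "('a, 'b) monoid_scheme \<Rightarrow> 'a metric \<Rightarrow> ('a \<Rightarrow> real) topology" where
  "lipschitz_topology G d =
     subtopology (powertop_real (carrier G)) (lipschitz_functionals G d)"

definition busemann_fun :: "('a, 'b) monoid_scheme \<Rightarrow> 'a metric \<Rightarrow> 'a \<Rightarrow> 'a \<Rightarrow> real" where
  "busemann_fun G d x = (\<lambda>y \<in> carrier G. mdist d x y - mdist d x \<one>\<^bsub>G\<^esub>)"

definition metric_functional_boundary ::
    "('a, 'b) monoid_scheme \<Rightarrow> 'a metric \<Rightarrow> ('a \<Rightarrow> real) set" where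
  "metric_functional_boundary G d =
     (lipschitz_topology G d closure_of (busemann_fun G d ` carrier G))
       - busemann_fun G d ` carrier G"


section \<open>Banach metrics\<close>

text \<open>The notion presupposes a finitely generated infinite group; these requirements are part of
  the predicate.\<close>

definition banach_metric :: "('a, 'b) monoid_scheme \<Rightarrow> 'a metric \<Rightarrow> bool" where
  "banach_metric G d \<longleftrightarrow>
     group G \<and> finitely_generated_group G \<and> infinite (carrier G) \<and>
     mspace d = carrier G \<and>
     (\<forall>x \<in> carrier G. \<forall>y \<in> carrier G. mdist d x y \<in> \<nat>) \<and>
     (\<forall>x \<in> carrier G. \<forall>y \<in> carrier G. \<forall>z \<in> carrier G.
        mdist d (z \<otimes>\<^bsub>G\<^esub> x) (z \<otimes>\<^bsub>G\<^esub> y) = mdist d x y) \<and>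
     (\<forall>r > 0. finite {x \<in> carrier G. mdist d x \<one>\<^bsub>G\<^esub> \<le> r}) \<and>
     (\<exists>S. fin_sym_generating_set G S \<and> quasi_isometric d (cayley_metric G S)) \<and>
     (\<forall>h \<in> metric_functional_boundary G d. \<not> bounded (h ` carrier G))"

end

theory Submission
  imports Defs
begin

text \<open>
  Coarse geometry of \<open>H\<close>: since \<open>H\<close> has finite index, it is coarsely dense in \<open>G\<close>, so a
  quasi-isometry from \<open>(G, d)\<close> to a Cayley graph of \<open>G\<close> restricts to a quasi-isometry on \<open>H\<close>. Walks
  in that Cayley graph are then pulled back to chains in \<open>H\<close> with bounded jumps; by left invariance
  and properness a ball of \<open>H\<close> is a finite generating set whose word metric is comparable to \<open>d\<close>.

  Boundary: by compactness every metric-functional of \<open>H\<close> extends to a point of the closure of the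
  functions \<open>b\<^sub>x\<close>, \<open>x \<in> G\<close>. The extension is unbounded on \<open>G\<close> (either it is a metric-functional, or it
  is some \<open>b\<^sub>x\<close>, which is unbounded by properness), and being Lipschitz it cannot be bounded on the
  coarsely dense subset \<open>H\<close>.
\<close>

section \<open>Coarse density and restriction of quasi-isometries\<close>

text \<open>Right cosets suit left invariance: for \<open>g = h t\<close> with \<open>h\<close> in
  \<open>H\<close>, translating by \<open>h\<close> gives \<open>d(g, h) = d(t, 1)\<close>, which
  depends only on the representative \<open>t\<close> of the coset.\<close>

lemma subgroup_finite_index_coarsely_dense:
  fixes G :: "('a, 'b) monoid_scheme" and d :: "'a metric"
  assumes "group G" and H: "subgroup H G" and fin: "finite (rcosets\<^bsub>G\<^esub> H)"
    and linv: "\<And>x y z. x \<in> carrier G \<Longrightarrow> y \<in> carrier G \<Longrightarrow> z \<in> carrier G \<Longrightarrow>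
      mdist d (z \<otimes>\<^bsub>G\<^esub> x) (z \<otimes>\<^bsub>G\<^esub> y) = mdist d x y"
  obtains M where "M \<ge> 0" and "\<And>g. g \<in> carrier G \<Longrightarrow> \<exists>h\<in>H. mdist d g h \<le> M"
proof -
  interpret group G by fact
  have HG: "H \<subseteq> carrier G" by (rule subgroup.subset [OF H])
  have "rcosets\<^bsub>G\<^esub> H = (\<lambda>a. H #>\<^bsub>G\<^esub> a) ` carrier G"
    by (auto simp: RCOSETS_def)
  with fin obtain T where T: "T \<subseteq> carrier G" "finite T"
      "rcosets\<^bsub>G\<^esub> H = (\<lambda>a. H #>\<^bsub>G\<^esub> a) ` T"
    by (metis finite_subset_image order_refl)
  \<comment> \<open>The sum over the finite transversal \<open>T\<close> serves as a common bound in
    place of the maximum.\<close>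
  have "\<exists>h\<in>H. mdist d g h \<le> (\<Sum>t\<in>T. mdist d t \<one>\<^bsub>G\<^esub>)" if g: "g \<in> carrier G" for g
  proof -
    have "H #>\<^bsub>G\<^esub> g \<in> rcosets\<^bsub>G\<^esub> H"
      using g by (auto simp: RCOSETS_def)
    then obtain t where t: "t \<in> T" "H #>\<^bsub>G\<^esub> g = H #>\<^bsub>G\<^esub> t"
      using T by auto
    have "g \<in> H #>\<^bsub>G\<^esub> t"
      using rcos_self [OF g H] t by simp
    then obtain h where h: "h \<in> H" "g = h \<otimes>\<^bsub>G\<^esub> t"
      by (auto simp: r_coset_def)
    have "mdist d g h = mdist d (h \<otimes>\<^bsub>G\<^esub> t) (h \<otimes>\<^bsub>G\<^esub> \<one>\<^bsub>G\<^esub>)"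
      using h HG by auto
    also have "\<dots> = mdist d t \<one>\<^bsub>G\<^esub>"
      using h t HG T by (intro linv) auto
    also have "\<dots> \<le> (\<Sum>t\<in>T. mdist d t \<one>\<^bsub>G\<^esub>)"
      using t T by (intro member_le_sum) auto
    finally show ?thesis using h by blast
  qed
  then show thesis
    by (rule that [rotated]) (auto intro: sum_nonneg)
qed

text \<open>The same map \<open>\<phi>\<close> is kept on \<open>A\<close>. Only coarse surjectivity
  has a real cost: a preimage outside \<open>A\<close> is moved to a point of \<open>A\<close>
  within \<open>M\<close>.\<close>

lemma quasi_isometric_submetric:
  assumes "quasi_isometric X Y" and "A \<subseteq> mspace X"
    and M: "M \<ge> 0" and dense: "\<And>x. x \<in> mspace X \<Longrightarrow> \<exists>a\<in>A. mdist X x a \<le> M"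
  shows "quasi_isometric (submetric X A) Y"
proof -
  obtain \<phi> C where \<phi>: "\<phi> \<in> mspace X \<rightarrow> mspace Y" and C: "C > 0"
    and surj: "\<And>y. y \<in> mspace Y \<Longrightarrow> \<exists>x\<in>mspace X. mdist Y (\<phi> x) y \<le> C"
    and lower: "\<And>x x'. x \<in> mspace X \<Longrightarrow> x' \<in> mspace X \<Longrightarrow>
      inverse C * mdist X x x' - C \<le> mdist Y (\<phi> x) (\<phi> x')"
    and upper: "\<And>x x'. x \<in> mspace X \<Longrightarrow> x' \<in> mspace X \<Longrightarrow>
      mdist Y (\<phi> x) (\<phi> x') \<le> C * mdist X x x' + C"
    using assms(1) unfolding quasi_isometric_def by blast
  \<comment> \<open>Moving the preimage by at most \<open>M\<close> moves its image by at most
    \<open>C * M + C\<close>; the other \<open>C\<close> is the original surjectivity error.\<close>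
  define D where "D = 2 * C + C * M"
  have CD: "C \<le> D" "D > 0"
    using C M by (auto simp: D_def add_pos_nonneg)
  have A: "a \<in> mspace X" if "a \<in> A" for a
    using that assms(2) by blast
  have "\<exists>a\<in>A. mdist Y (\<phi> a) y \<le> D" if y: "y \<in> mspace Y" for y
  proof -
    obtain x where x: "x \<in> mspace X" "mdist Y (\<phi> x) y \<le> C"
      using surj [OF y] by blast
    obtain a where a: "a \<in> A" "mdist X x a \<le> M"
      using dense [OF x(1)] by blast
    have "mdist Y (\<phi> a) y \<le> mdist Y (\<phi> a) (\<phi> x) + mdist Y (\<phi> x) y"
      using \<phi> x y A [OF a(1)] by (intro mdist_triangle) auto
    also have "mdist Y (\<phi> a) (\<phi> x) \<le> C * mdist X x a + C"
      using upper [OF x(1) A [OF a(1)]] by (simp add: mdist_commute)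
    also have "C * mdist X x a \<le> C * M"
      using a C by simp
    finally show ?thesis using x a by (intro bexI [of _ a]) (auto simp: D_def)
  qed
  moreover have "inverse D * mdist X a b - D \<le> mdist Y (\<phi> a) (\<phi> b)"
    and "mdist Y (\<phi> a) (\<phi> b) \<le> D * mdist X a b + D" if "a \<in> A" "b \<in> A" for a b
  proof -
    have "inverse D * mdist X a b \<le> inverse C * mdist X a b"
      using C CD by (intro mult_right_mono le_imp_inverse_le) auto
    then show "inverse D * mdist X a b - D \<le> mdist Y (\<phi> a) (\<phi> b)"
      using lower [of a b] A that CD by fastforce
    have "C * mdist X a b \<le> D * mdist X a b"
      using CD by (intro mult_right_mono) auto
    then show "mdist Y (\<phi> a) (\<phi> b) \<le> D * mdist X a b + D"
      using upper [of a b] A that CD by fastforce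
  qed
  ultimately show ?thesis
    using assms(2) \<phi> CD unfolding quasi_isometric_def
    by (intro bexI [of _ \<phi>] exI [of _ D]) (auto simp: mdist_submetric Int_absorb2 Pi_iff)
qed

section \<open>Word metrics whose generators form a ball\<close>

text \<open>The labels along a walk telescope to the quotient of its endpoints. This will show that
  a ball generates the group once its Cayley graph is connected.\<close>

lemma cayley_walk_imp_generate:
  assumes "group G" and S: "S \<subseteq> carrier G"
    and "(x, y) \<in> cayley_edges G S ^^ n" and "x \<in> carrier G"
  shows "inv\<^bsub>G\<^esub> x \<otimes>\<^bsub>G\<^esub> y \<in> generate G S"
  using assms(3)
proof (induction n arbitrary: y)
  case 0
  interpret group G by fact
  show ?case using 0 assms(4) by (auto intro: generate.one)
next
  case (Suc n)
  interpret group G by fact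
  obtain z where z: "(x, z) \<in> cayley_edges G S ^^ n" "(z, y) \<in> cayley_edges G S"
    using Suc.prems by auto
  then have zy: "z \<in> carrier G" "y \<in> carrier G" "inv\<^bsub>G\<^esub> z \<otimes>\<^bsub>G\<^esub> y \<in> S"
    by (auto simp: cayley_edges_def)
  have "(inv\<^bsub>G\<^esub> x \<otimes>\<^bsub>G\<^esub> z) \<otimes>\<^bsub>G\<^esub> (inv\<^bsub>G\<^esub> z \<otimes>\<^bsub>G\<^esub> y) \<in> generate G S"
    using Suc.IH [OF z(1)] zy by (blast intro: generate.eng generate.incl)
  also have "(inv\<^bsub>G\<^esub> x \<otimes>\<^bsub>G\<^esub> z) \<otimes>\<^bsub>G\<^esub> (inv\<^bsub>G\<^esub> z \<otimes>\<^bsub>G\<^esub> y) = inv\<^bsub>G\<^esub> x \<otimes>\<^bsub>G\<^esub> y"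
    using zy assms(4) by (metis inv_closed inv_solve_left m_assoc m_closed)
  finally show ?case .
qed

text \<open>A variant of the Milnor--Schwarz lemma. The group \<open>G\<close> of the given Cayley graph is unrelated to
  \<open>K\<close>, which is what allows the lemma to be applied to a subgroup.\<close>

lemma quasi_isometric_cayley_metric_self:
  fixes K :: "('a, 'b) monoid_scheme" and G :: "('c, 'e) monoid_scheme" and d :: "'a metric"
  assumes "group K" and K: "mspace d = carrier K"
    and linv: "\<And>x y z. x \<in> carrier K \<Longrightarrow> y \<in> carrier K \<Longrightarrow> z \<in> carrier K \<Longrightarrow>
      mdist d (z \<otimes>\<^bsub>K\<^esub> x) (z \<otimes>\<^bsub>K\<^esub> y) = mdist d x y"
    and proper: "\<And>r. r > 0 \<Longrightarrow> finite {x \<in> carrier K. mdist d x \<one>\<^bsub>K\<^esub> \<le> r}"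
    and "group G" and S: "fin_sym_generating_set G S"
    and qi: "quasi_isometric d (cayley_metric G S)"
  obtains B where "fin_sym_generating_set K B" and "quasi_isometric d (cayley_metric K B)"
proof -
  interpret K: group K by fact
  let ?D = "mdist (cayley_metric G S)"
  note msp = mspace_cayley_metric [OF \<open>group G\<close> S] and mdi = mdist_cayley_metric [OF \<open>group G\<close> S]
  obtain \<phi> C where \<phi>: "\<phi> \<in> carrier K \<rightarrow> carrier G" and C: "C > 0"
    and surj: "\<And>y. y \<in> carrier G \<Longrightarrow> \<exists>x\<in>carrier K. ?D (\<phi> x) y \<le> C"
    and lower: "\<And>x x'. x \<in> carrier K \<Longrightarrow> x' \<in> carrier K \<Longrightarrow>
      inverse C * mdist d x x' - C \<le> ?D (\<phi> x) (\<phi> x')"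
    and upper: "\<And>x x'. x \<in> carrier K \<Longrightarrow> x' \<in> carrier K \<Longrightarrow>
      ?D (\<phi> x) (\<phi> x') \<le> C * mdist d x x' + C"
    using qi unfolding quasi_isometric_def msp K by blast
  \<comment> \<open>Solving the lower quasi-isometry bound for the distance of two points whose
    images are at most \<open>2 * C + 1\<close> apart gives exactly \<open>R\<close>.\<close>
  define R where "R = C * (3 * C + 1)"
  define B where "B = {x \<in> carrier K. mdist d x \<one>\<^bsub>K\<^esub> \<le> R}"
  have R: "R > 0" using C by (simp add: R_def)
  have close: "mdist d x y \<le> R"
    if "x \<in> carrier K" "y \<in> carrier K" "?D (\<phi> x) (\<phi> y) \<le> 2 * C + 1" for x y
  proof -
    have "inverse C * mdist d x y \<le> 3 * C + 1"
      using lower [OF that(1,2)] that(3) by linarith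
    then show ?thesis using C by (simp add: R_def field_simps)
  qed
  have shift: "mdist d (inv\<^bsub>K\<^esub> x \<otimes>\<^bsub>K\<^esub> y) \<one>\<^bsub>K\<^esub> = mdist d x y"
    if "x \<in> carrier K" "y \<in> carrier K" for x y
    using linv [of "inv\<^bsub>K\<^esub> x \<otimes>\<^bsub>K\<^esub> y" "\<one>\<^bsub>K\<^esub>" x] that
    by (simp add: K.m_assoc [symmetric] mdist_commute)
  have edge: "(x, y) \<in> cayley_edges K B \<longleftrightarrow>
      x \<in> carrier K \<and> y \<in> carrier K \<and> mdist d x y \<le> R" for x y
    by (auto simp: cayley_edges_def B_def shift)
  \<comment> \<open>Each vertex of a walk in \<open>G\<close> is shadowed by a point of
    \<open>K\<close> whose image is within \<open>C\<close> of it. Images of successive shadows are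
    at most \<open>C + 1 + C\<close> apart, so the shadows are joined by an edge.\<close>
  have chain: "\<exists>y\<in>carrier K. (x, y) \<in> cayley_edges K B ^^ m \<and> ?D (\<phi> y) b \<le> C"
    if "(\<phi> x, b) \<in> cayley_edges G S ^^ m" "x \<in> carrier K" for x b m
    using that
  proof (induction m arbitrary: b)
    case 0
    have "?D (\<phi> x) (\<phi> x) = 0" using 0 \<phi> by (subst mdist_zero) (auto simp: msp)
    with 0 C show ?case by (intro bexI [of _ x]) auto
  next
    case (Suc m)
    then obtain c where c: "(\<phi> x, c) \<in> cayley_edges G S ^^ m" "(c, b) \<in> cayley_edges G S"
      by auto
    then have cb: "c \<in> carrier G" "b \<in> carrier G"
      by (auto simp: cayley_edges_def)
    obtain y where y: "y \<in> carrier K" "(x, y) \<in> cayley_edges K B ^^ m" "?D (\<phi> y) c \<le> C"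
      using Suc c by blast
    obtain z where z: "z \<in> carrier K" "?D (\<phi> z) b \<le> C"
      using surj [OF cb(2)] by blast
    have \<phi>yz: "\<phi> y \<in> carrier G" "\<phi> z \<in> carrier G"
      using \<phi> y z by auto
    have "?D c b \<le> 1"
      using cayley_dist_le [of c b 1] c by (simp add: mdi)
    moreover have "?D (\<phi> y) (\<phi> z) \<le> ?D (\<phi> y) c + ?D c (\<phi> z)"
      using \<phi>yz cb by (intro mdist_triangle) (auto simp: msp)
    moreover have "?D c (\<phi> z) \<le> ?D c b + ?D b (\<phi> z)"
      using \<phi>yz cb by (intro mdist_triangle) (auto simp: msp)
    ultimately have "?D (\<phi> y) (\<phi> z) \<le> 2 * C + 1"
      using y z by (simp add: mdist_commute)
    then have "(y, z) \<in> cayley_edges K B"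
      using y z close by (simp add: edge)
    then show ?case
      using y z by auto
  qed
  \<comment> \<open>The last shadow \<open>z\<close> of the lifted walk need not be \<open>y\<close>
    itself; the extra edge, counted by \<open>Suc\<close>, joins \<open>z\<close> to
    \<open>y\<close>.\<close>
  have walk: "(x, y) \<in> cayley_edges K B ^^ Suc (cayley_dist G S (\<phi> x) (\<phi> y))"
    if xy: "x \<in> carrier K" "y \<in> carrier K" for x y
  proof -
    have "(\<phi> x, \<phi> y) \<in> cayley_edges G S ^^ cayley_dist G S (\<phi> x) (\<phi> y)"
      using xy \<phi> by (intro cayley_walk_exists [OF \<open>group G\<close> S]) auto
    then obtain z where z: "z \<in> carrier K" "?D (\<phi> z) (\<phi> y) \<le> C"
        "(x, z) \<in> cayley_edges K B ^^ cayley_dist G S (\<phi> x) (\<phi> y)"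
      using chain xy by blast
    then have "(z, y) \<in> cayley_edges K B"
      using close [of z y] xy C by (simp add: edge)
    then show ?thesis using z by auto
  qed
  have walk_length: "mdist d x y \<le> R * real n"
    if "(x, y) \<in> cayley_edges K B ^^ n" "x \<in> carrier K" for x y n
    using that
  proof (induction n arbitrary: y)
    case 0
    then have "mdist d x y = 0" by (subst mdist_zero) (auto simp: K)
    then show ?case by simp
  next
    case (Suc n)
    then obtain z where z: "(x, z) \<in> cayley_edges K B ^^ n" "(z, y) \<in> cayley_edges K B"
      by auto
    then have "mdist d x y \<le> mdist d x z + mdist d z y"
      using Suc.prems by (intro mdist_triangle) (auto simp: K edge)
    then show ?case
      using Suc.IH [OF z(1)] z Suc.prems by (auto simp: edge algebra_simps)
  qed
  have BK: "B \<subseteq> carrier K" by (auto simp: B_def)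
  have B: "fin_sym_generating_set K B"
    unfolding fin_sym_generating_set_def
  proof (intro conjI BK)
    show "finite B" unfolding B_def by (rule proper [OF R])
    have inv: "inv\<^bsub>K\<^esub> x \<in> B" if "x \<in> B" for x
      using that shift [of x "\<one>\<^bsub>K\<^esub>"] by (auto simp: B_def)
    show "m_inv K ` B = B"
    proof
      show "m_inv K ` B \<subseteq> B" using inv by blast
      show "B \<subseteq> m_inv K ` B"
      proof
        fix x assume "x \<in> B"
        then have "x = inv\<^bsub>K\<^esub> (inv\<^bsub>K\<^esub> x)" using BK by auto
        then show "x \<in> m_inv K ` B" using inv [OF \<open>x \<in> B\<close>] by blast
      qed
    qed
    show "generate K B = carrier K"
    proof
      show "generate K B \<subseteq> carrier K"
        using K.generate_in_carrier [OF BK] by blast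
      show "carrier K \<subseteq> generate K B"
      proof
        fix x assume x: "x \<in> carrier K"
        then show "x \<in> generate K B"
          using cayley_walk_imp_generate [OF \<open>group K\<close> BK walk [of "\<one>\<^bsub>K\<^esub>" x]] by simp
      qed
    qed
  qed
  \<comment> \<open>\<open>R\<close> bounds the length of an edge, \<open>C\<close> comes from the
    upper bound for \<open>\<phi>\<close>, and \<open>1\<close> pays for the extra edge of the
    lifted walk.\<close>
  define C' where "C' = C + 1 + R"
  have C': "C' > 0" "C \<le> C'" "R \<le> C'" using C R by (auto simp: C'_def)
  have "inverse C' * mdist d x y - C' \<le> real (cayley_dist K B x y)"
    and "real (cayley_dist K B x y) \<le> C' * mdist d x y + C'"
    if xy: "x \<in> carrier K" "y \<in> carrier K" for x y
  proof -
    have "mdist d x y \<le> R * real (cayley_dist K B x y)"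
      using walk_length cayley_walk_exists [OF \<open>group K\<close> B xy] xy by blast
    also have "\<dots> \<le> C' * real (cayley_dist K B x y)"
      using C' by (intro mult_right_mono) auto
    finally have "inverse C' * mdist d x y \<le> real (cayley_dist K B x y)"
      using C' by (simp add: field_simps)
    then show "inverse C' * mdist d x y - C' \<le> real (cayley_dist K B x y)"
      using C' by linarith
    have "real (cayley_dist K B x y) \<le> 1 + ?D (\<phi> x) (\<phi> y)"
      using cayley_dist_le [OF walk [OF xy]] by (simp add: mdi)
    also have "\<dots> \<le> 1 + (C * mdist d x y + C)"
      using upper [OF xy] by simp
    also have "C * mdist d x y \<le> C' * mdist d x y"
      using C' by (intro mult_right_mono) auto
    finally show "real (cayley_dist K B x y) \<le> C' * mdist d x y + C'"
      using R by (simp add: C'_def)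
  qed
  moreover have "\<exists>x\<in>carrier K. real (cayley_dist K B x y) \<le> C'" if "y \<in> carrier K" for y
    using that C' cayley_dist_le [of y y 0 K B] by (intro bexI [of _ y]) auto
  \<comment> \<open>The comparison of the two metrics makes the identity map a
    quasi-isometry.\<close>
  ultimately have "quasi_isometric d (cayley_metric K B)"
    unfolding quasi_isometric_def mspace_cayley_metric [OF \<open>group K\<close> B]
      mdist_cayley_metric [OF \<open>group K\<close> B] K
    using C' by (intro bexI [of _ "\<lambda>x. x"] exI [of _ C']) auto
  with B show thesis by (rule that)
qed

section \<open>Compactness and extension of metric-functionals\<close>

text \<open>The normalisation at the identity confines each value \<open>h y\<close> to a compact
  interval, so Tychonoff applies to the product. The defining conditions are closed, each involving
  at most two coordinates.\<close>

lemma compactin_lipschitz_functionals: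
  fixes G :: "('a, 'b) monoid_scheme" and d :: "'a metric"
  assumes "group G"
  shows "compactin (powertop_real (carrier G)) (lipschitz_functionals G d)"
proof (rule closed_compactin)
  interpret group G by fact
  let ?X = "powertop_real (carrier G)"
  let ?K = "\<Pi>\<^sub>E y\<in>carrier G. {- mdist d y \<one>\<^bsub>G\<^esub>..mdist d y \<one>\<^bsub>G\<^esub>}"
  show "compactin ?X ?K"
    by (simp add: compactin_PiE)
  show "lipschitz_functionals G d \<subseteq> ?K"
  proof
    fix h assume h: "h \<in> lipschitz_functionals G d"
    have "\<bar>h y\<bar> \<le> mdist d y \<one>\<^bsub>G\<^esub>" if "y \<in> carrier G" for y
    proof -
      have "h \<one>\<^bsub>G\<^esub> = 0" "\<bar>h y - h \<one>\<^bsub>G\<^esub>\<bar> \<le> mdist d y \<one>\<^bsub>G\<^esub>"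
        using h that one_closed unfolding lipschitz_functionals_def by blast+
      then show ?thesis by simp
    qed
    then show "h \<in> ?K"
      using h by (auto simp: PiE_iff lipschitz_functionals_def abs_le_iff minus_le_iff)
  qed
  have proj: "continuous_map ?X euclideanreal (\<lambda>h. h x)" if "x \<in> carrier G" for x
    using that by (rule continuous_map_product_projection)
  have zero: "closedin ?X {h \<in> topspace ?X. h \<one>\<^bsub>G\<^esub> \<in> {0}}"
    by (rule closedin_continuous_map_preimage [OF proj]) auto
  have lip: "closedin ?X {h \<in> topspace ?X. h x - h y \<in> {- mdist d x y..mdist d x y}}"
    if "x \<in> carrier G" "y \<in> carrier G" for x y
    by (rule closedin_continuous_map_preimage
        [OF continuous_map_diff [OF proj [OF that(1)] proj [OF that(2)]]]) auto
  have "lipschitz_functionals G d =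
      {h \<in> topspace ?X. h \<one>\<^bsub>G\<^esub> \<in> {0}} \<inter>
      (\<Inter>x\<in>carrier G. \<Inter>y\<in>carrier G. {h \<in> topspace ?X. h x - h y \<in> {- mdist d x y..mdist d x y}})"
    by (fastforce simp: lipschitz_functionals_def PiE_iff abs_le_iff)
  also have "closedin ?X \<dots>"
    using one_closed lip zero by (intro closedin_Int closedin_INT) auto
  finally show "closedin ?X (lipschitz_functionals G d)" .
qed

lemma busemann_fun_in_lipschitz_functionals:
  assumes "group G" and "mspace d = carrier G" and "x \<in> carrier G"
  shows "busemann_fun G d x \<in> lipschitz_functionals G d"
proof -
  interpret group G by fact
  have "\<bar>mdist d x y - mdist d x z\<bar> \<le> mdist d y z" if "y \<in> carrier G" "z \<in> carrier G" for y z
    using mdist_triangle [of x d y z] mdist_triangle [of x d z y] that assms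
    by (auto simp: mdist_commute)
  then show ?thesis
    by (auto simp: busemann_fun_def lipschitz_functionals_def)
qed

lemma restrict_busemann_fun:
  assumes "subgroup H G" and "x \<in> H" and "H \<subseteq> mspace d"
  shows "restrict (busemann_fun G d x) H = busemann_fun (G\<lparr>carrier := H\<rparr>) (submetric d H) x"
  using assms subgroup.subset [OF assms(1)] subgroup.one_closed [OF assms(1)]
  by (auto simp: busemann_fun_def fun_eq_iff mdist_submetric)

text \<open>Restriction to \<open>H\<close> is continuous, so it maps a compact closure onto a
  compact, hence closed, set. That set contains the functions \<open>busemann_fun\<close> of
  \<open>H\<close> and therefore all their limits. The extension may turn out to be some
  \<open>busemann_fun G d x\<close>, so only membership in the closure is claimed.\<close>

lemma metric_functional_boundary_subgroup_extend:
  fixes G :: "('a, 'b) monoid_scheme" and d :: "'a metric"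
  assumes "group G" and H: "subgroup H G" and d: "mspace d = carrier G"
    and h: "h \<in> metric_functional_boundary (G\<lparr>carrier := H\<rparr>) (submetric d H)"
  obtains h' where "h' \<in> lipschitz_functionals G d"
    and "h' \<in> lipschitz_topology G d closure_of (busemann_fun G d ` carrier G)"
    and "h = restrict h' H"
proof -
  let ?X = "powertop_real (carrier G)" and ?Y = "powertop_real H"
  let ?b = "busemann_fun G d"
  let ?c = "busemann_fun (G\<lparr>carrier := H\<rparr>) (submetric d H)"
  let ?L = "lipschitz_functionals G d"
  have HG: "H \<subseteq> carrier G" by (rule subgroup.subset [OF H])
  have L: "compactin ?X ?L"
    by (rule compactin_lipschitz_functionals [OF \<open>group G\<close>])
  have bL: "?b ` carrier G \<subseteq> ?L"
    using busemann_fun_in_lipschitz_functionals [OF \<open>group G\<close> d] by blast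
  let ?F = "?X closure_of (?b ` carrier G)"
  \<comment> \<open>Base points are taken in \<open>H\<close> because for these the restriction is
    again a function \<open>busemann_fun\<close> of \<open>H\<close>.\<close>
  let ?E = "?X closure_of (?b ` H)"
  have haus: "Hausdorff_space ?X" "Hausdorff_space ?Y"
    by (simp_all add: Hausdorff_space_product_topology)
  have FL: "?F \<subseteq> ?L"
    using bL compactin_imp_closedin [OF haus(1) L] by (rule closure_of_minimal)
  have EF: "?E \<subseteq> ?F"
    using HG by (intro closure_of_mono) blast
  have "compactin ?X ?E"
    using EF FL by (intro closed_compactin [OF L]) auto
  moreover have "continuous_map ?X ?Y (\<lambda>f. restrict f H)"
    using HG by (auto simp: continuous_map_componentwise continuous_map_product_projection
        intro: continuous_map_eq [OF continuous_map_product_projection])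
  ultimately have "closedin ?Y ((\<lambda>f. restrict f H) ` ?E)"
    by (intro compactin_imp_closedin [OF haus(2)] image_compactin)
  moreover have "?c ` H \<subseteq> (\<lambda>f. restrict f H) ` ?E"
  proof
    fix f assume "f \<in> ?c ` H"
    then obtain x where x: "x \<in> H" "f = restrict (?b x) H"
      using restrict_busemann_fun [OF H] HG d by auto
    have "?b ` H \<subseteq> ?E"
      by (intro closure_of_subset) (auto simp: busemann_fun_def)
    then show "f \<in> (\<lambda>f. restrict f H) ` ?E"
      using x by blast
  qed
  ultimately have "?Y closure_of (?c ` H) \<subseteq> (\<lambda>f. restrict f H) ` ?E"
    by (intro closure_of_minimal)
  moreover have "h \<in> ?Y closure_of (?c ` H)"
    using h closure_of_subtopology_subset
    unfolding metric_functional_boundary_def lipschitz_topology_def by fastforce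
  ultimately obtain h' where h': "h' \<in> ?E" "h = restrict h' H"
    by blast
  have "h' \<in> ?L" using h' EF FL by blast
  \<comment> \<open>Closure in the subspace is the ambient closure intersected with
    \<open>?L\<close>, as the functions \<open>?b x\<close> already lie in
    \<open>?L\<close>.\<close>
  moreover have "h' \<in> lipschitz_topology G d closure_of (?b ` carrier G)"
    unfolding lipschitz_topology_def closure_of_subtopology
    using \<open>h' \<in> ?L\<close> h' EF bL by (simp add: Int_absorb1) blast
  ultimately show thesis
    using h'(2) by (rule that)
qed

section \<open>Unboundedness on the group and on the subgroup\<close>

text \<open>The triangle inequality gives \<open>d(y, 1) \<le> b_x(y) + 2 d(x, 1)\<close>, so a
  bound on \<open>b_x\<close> would place the infinite group inside a finite ball. This settles the
  case in which an extended functional is not a boundary point.\<close>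

lemma unbounded_busemann_fun:
  assumes "group G" and "mspace d = carrier G" and inf: "infinite (carrier G)"
    and proper: "\<And>r. r > 0 \<Longrightarrow> finite {x \<in> carrier G. mdist d x \<one>\<^bsub>G\<^esub> \<le> r}"
    and x: "x \<in> carrier G"
  shows "\<not> bounded (busemann_fun G d x ` carrier G)"
proof
  interpret group G by fact
  assume "bounded (busemann_fun G d x ` carrier G)"
  then obtain a where a: "a > 0" "\<And>y. y \<in> carrier G \<Longrightarrow> \<bar>busemann_fun G d x y\<bar> \<le> a"
    unfolding bounded_pos by auto
  have "mdist d y \<one>\<^bsub>G\<^esub> \<le> a + 2 * mdist d x \<one>\<^bsub>G\<^esub>" if "y \<in> carrier G" for y
    using a(2) [OF that] mdist_triangle [of y d x "\<one>\<^bsub>G\<^esub>"] that assms(2) x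
    by (simp add: busemann_fun_def mdist_commute abs_le_iff)
  then have "carrier G \<subseteq> {y \<in> carrier G. mdist d y \<one>\<^bsub>G\<^esub> \<le> a + 2 * mdist d x \<one>\<^bsub>G\<^esub>}"
    by blast
  moreover have "finite \<dots>"
    using a(1) by (intro proper) (simp add: add_pos_nonneg)
  ultimately show False
    using inf finite_subset by blast
qed

text \<open>Passing from \<open>g\<close> to a point of \<open>H\<close> within \<open>M\<close>
  changes the value by at most \<open>M\<close>. The lemma transfers unboundedness on the group to
  \<open>H\<close> by contraposition.\<close>

lemma lipschitz_functional_bounded_on_coarsely_dense:
  assumes h: "h \<in> lipschitz_functionals G d" and "H \<subseteq> carrier G"
    and dense: "\<And>g. g \<in> carrier G \<Longrightarrow> \<exists>y\<in>H. mdist d g y \<le> M"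
    and "bounded (h ` H)"
  shows "bounded (h ` carrier G)"
proof -
  obtain a where a: "\<And>y. y \<in> H \<Longrightarrow> \<bar>h y\<bar> \<le> a"
    using assms(4) unfolding bounded_iff by auto
  have "\<bar>h g\<bar> \<le> a + M" if g: "g \<in> carrier G" for g
  proof -
    obtain y where y: "y \<in> H" "mdist d g y \<le> M"
      using dense [OF g] by blast
    then have "\<bar>h g - h y\<bar> \<le> mdist d g y"
      using h g assms(2) by (auto simp: lipschitz_functionals_def)
    then show ?thesis using a [OF y(1)] y by linarith
  qed
  then show ?thesis unfolding bounded_iff by auto
qed

section \<open>Verification of the Banach conditions on the subgroup\<close>

theorem theorem2p6:
  fixes G :: "('a, 'b) monoid_scheme" and H :: "'a set" and d :: "'a metric"
  assumes "group G" and "finitely_generated_group G"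
    and "subgroup H G" and "finite (rcosets\<^bsub>G\<^esub> H)"
    and "banach_metric G d"
  shows "banach_metric (G\<lparr>carrier := H\<rparr>) (submetric d H)"
proof -
  interpret group G by fact
  interpret H: group "G\<lparr>carrier := H\<rparr>"
    using assms(1,3) by (simp add: subgroup_imp_group)
  let ?K = "G\<lparr>carrier := H\<rparr>" and ?d = "submetric d H"
  have HG: "H \<subseteq> carrier G" by (rule subgroup.subset [OF assms(3)])
  have inf: "infinite (carrier G)" and d: "mspace d = carrier G"
    and int: "\<And>x y. x \<in> carrier G \<Longrightarrow> y \<in> carrier G \<Longrightarrow> mdist d x y \<in> \<nat>"
    and linv: "\<And>x y z. x \<in> carrier G \<Longrightarrow> y \<in> carrier G \<Longrightarrow> z \<in> carrier G \<Longrightarrow>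
      mdist d (z \<otimes>\<^bsub>G\<^esub> x) (z \<otimes>\<^bsub>G\<^esub> y) = mdist d x y"
    and proper: "\<And>r. r > 0 \<Longrightarrow> finite {x \<in> carrier G. mdist d x \<one>\<^bsub>G\<^esub> \<le> r}"
    and bdry: "\<And>h. h \<in> metric_functional_boundary G d \<Longrightarrow> \<not> bounded (h ` carrier G)"
    using assms(5) unfolding banach_metric_def by blast+
  obtain S where S: "fin_sym_generating_set G S" "quasi_isometric d (cayley_metric G S)"
    using assms(5) unfolding banach_metric_def by blast
  obtain M where M: "M \<ge> 0" "\<And>g. g \<in> carrier G \<Longrightarrow> \<exists>h\<in>H. mdist d g h \<le> M"
    using subgroup_finite_index_coarsely_dense [OF assms(1,3,4), of d] linv by blast
  have dH: "mspace ?d = carrier ?K"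
    using HG d by auto
  have linvH: "mdist ?d (z \<otimes>\<^bsub>?K\<^esub> x) (z \<otimes>\<^bsub>?K\<^esub> y) = mdist ?d x y"
    if "x \<in> carrier ?K" "y \<in> carrier ?K" "z \<in> carrier ?K" for x y z
    using that HG linv [of x y z] by (auto simp: mdist_submetric)
  have properH: "finite {x \<in> carrier ?K. mdist ?d x \<one>\<^bsub>?K\<^esub> \<le> r}" if "r > 0" for r
    by (rule finite_subset [OF _ proper [OF that]]) (use HG in \<open>auto simp: mdist_submetric\<close>)
  have qi: "quasi_isometric ?d (cayley_metric G S)"
    using S(2) HG M d by (intro quasi_isometric_submetric [where M = M]) auto
  \<comment> \<open>The target so far is a Cayley graph of \<open>G\<close>; it is replaced here by
    one of \<open>H\<close>, which also yields finite generation of \<open>H\<close>.\<close>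
  obtain B where B: "fin_sym_generating_set ?K B" "quasi_isometric ?d (cayley_metric ?K B)"
    by (rule quasi_isometric_cayley_metric_self [OF H.is_group dH _ _ \<open>group G\<close> S(1) qi])
      (erule linvH properH that; assumption)+
  have "infinite H"
  proof
    assume "finite H"
    \<comment> \<open>Finitely many finite cosets would cover the infinite group.\<close>
    then have "finite (\<Union>(rcosets\<^bsub>G\<^esub> H))"
      using assms(4) HG by (auto simp: RCOSETS_def r_coset_def)
    then show False
      using inf rcosets_part_G [OF assms(3)] by simp
  qed
  moreover have "\<not> bounded (h ` H)" if h: "h \<in> metric_functional_boundary ?K ?d" for h
  proof
    assume bdd: "bounded (h ` H)"
    obtain h' where h': "h' \<in> lipschitz_functionals G d"
        "h' \<in> lipschitz_topology G d closure_of (busemann_fun G d ` carrier G)"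
        "h = restrict h' H"
      using metric_functional_boundary_subgroup_extend [OF assms(1,3) d h] by metis
    have "bounded (h' ` carrier G)"
      using h' bdd HG M by (intro lipschitz_functional_bounded_on_coarsely_dense) auto
    \<comment> \<open>A point of the closure is either a metric-functional, unbounded because
      \<open>d\<close> is Banach, or some \<open>busemann_fun G d x\<close>, unbounded by
      properness.\<close>
    moreover have "h' \<in> metric_functional_boundary G d \<or> h' \<in> busemann_fun G d ` carrier G"
      using h' by (auto simp: metric_functional_boundary_def)
    ultimately show False
      using bdry unbounded_busemann_fun [OF \<open>group G\<close> d inf proper] by blast
  qed
  moreover have "finitely_generated_group ?K"
    using B(1) unfolding fin_sym_generating_set_def finitely_generated_group_def by blast
  moreover have "mdist ?d x y \<in> \<nat>" if "x \<in> H" "y \<in> H" for x y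
    using that int HG by (auto simp: mdist_submetric)
  ultimately show ?thesis
    unfolding banach_metric_def
    using H.is_group dH linvH properH B by auto
qed

end
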